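(* Let $0<q<1$ and let $x$ be a real number with $|x|<1$. Let $r,s$ be non-negative integers and $k_1,\dots,k_r,l_1,\dots,l_s$ positive integers. If $s>0$, then \[ Z_q(k_1,\dots,k_r,1;\,l_1,\dots,l_s;\,x)=Z_q(k_1,\dots,k_r;\,l_1,\dots,l_{s-1},l_s+1;\,x), \] and if $r>0$, then \[ Z_q(k_1,\dots,k_{r-1},k_r+1;\,l_1,\dots,l_s;\,x)=Z_q(k_1,\dots,k_r;\,l_1,\dots,l_s,1;\,x), \] where both sides are understood as values in $(0,+\infty]$.
   Context: For a positive integer $m$, $[m]_q=\frac{1-q^m}{1-q}$. For a non-negative integer $m$, $f_q(m;x)=\prod_{h=1}^m([h]_q-q^hx)$ (so $f_q(0;x)=1$). An index is a finite (possibly empty) tuple of positive integers. For indices $\boldsymbol{k}=(k_1,\dots,k_r)$ and $\boldsymbol{l}=(l_1,\dots,l_s)$ (possibly empty, not necessarily with last entry $\ge 2$), the connected sum is \[ Z_q(\boldsymbol{k};\boldsymbol{l};x)=\sum_{\substack{0=m_0<m_1<\cdots<m_r\\ 0=n_0<n_1<\cdots<n_s}}\prod_{i=1}^r\frac{q^{(k_i-1)m_i}}{([m_i]_q-q^{m_i}x)[m_i]_q^{k_i-1}}\prod_{j=1}^s\frac{q^{(l_j-1)n_j}}{([n_j]_q-q^{n_j}x)[n_j]_q^{l_j-1}}\cdot\frac{q^{m_rn_s}f_q(m_r;x)f_q(n_s;x)}{f_q(m_r+n_s;x)}, \] where $m_r$ (resp. $n_s$) means $m_0=0$ if $r=0$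 (resp. $n_0=0$ if $s=0$). This is a series of positive terms, so its value is a well-defined element of $(0,+\infty]$ independent of the order of summation. *)

theory Defs
  imports "HOL-Analysis.Analysis"
begin

definition q_int :: "real \<Rightarrow> nat \<Rightarrow> real" where
  "q_int q m = (1 - q ^ m) / (1 - q)"

definition f_q :: "real \<Rightarrow> nat \<Rightarrow> real \<Rightarrow> real" where
  "f_q q m x = (\<Prod>h=1..m. q_int q h - q ^ h * x)"

definition is_index :: "nat list \<Rightarrow> bool" where
  "is_index ks \<longleftrightarrow> (\<forall>k\<in>set ks. 0 < k)"

text \<open>
  The entries of a list \<open>ms\<close> are \<open>m\<^sub>1, \<dots>, m\<^sub>r\<close>; the convention \<open>m\<^sub>0 = 0\<close> is realised by
  prepending \<open>0\<close>, so that \<open>last (0 # ms)\<close> is \<open>m\<^sub>r\<close> also for \<open>r = 0\<close>.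
\<close>

definition chains :: "nat \<Rightarrow> nat list set" where
  "chains r = {ms. length ms = r \<and> sorted_wrt (<) (0 # ms)}"

text \<open>
  List positions start at \<open>0\<close>: \<open>ks ! i\<close> and \<open>ms ! i\<close> are \<open>k\<^bsub>i+1\<^esub>\<close> and \<open>m\<^bsub>i+1\<^esub>\<close>.
\<close>

definition chain_weight :: "real \<Rightarrow> real \<Rightarrow> nat list \<Rightarrow> nat list \<Rightarrow> real" where
  "chain_weight q x ks ms =
     (\<Prod>i<length ks. q ^ ((ks ! i - 1) * ms ! i) /
        ((q_int q (ms ! i) - q ^ (ms ! i) * x) * q_int q (ms ! i) ^ (ks ! i - 1)))"

definition connector :: "real \<Rightarrow> real \<Rightarrow> nat \<Rightarrow> nat \<Rightarrow> real" where
  "connector q x m n = q ^ (m * n) * f_q q m x * f_q q n x / f_q q (m + n) x"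

definition Z_term :: "real \<Rightarrow> real \<Rightarrow> nat list \<Rightarrow> nat list \<Rightarrow> nat list \<Rightarrow> nat list \<Rightarrow> real" where
  "Z_term q x ks ls ms ns =
     chain_weight q x ks ms * chain_weight q x ls ns * connector q x (last (0 # ms)) (last (0 # ns))"

text \<open>
  The sum is taken in \<^typ>\<open>ennreal\<close>, where every family is summable, so divergence is the value
  \<open>\<infinity>\<close>. The truncation of negative reals by \<open>ennreal\<close> is irrelevant for
  \<open>0 < q < 1\<close> and \<open>\<bar>x\<bar> < 1\<close>: all terms are positive by \<open>Z_term_pos\<close> below.
\<close>

definition Z_q :: "real \<Rightarrow> nat list \<Rightarrow> nat list \<Rightarrow> real \<Rightarrow> ennreal" where
  "Z_q q ks ls x =
     (\<Sum>\<^sub>\<infinity>(ms, ns) \<in> chains (length ks) \<times> chains (length ls). ennreal (Z_term q x ks ls ms ns))"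

lemma q_int_ge_1:
  assumes "0 < q" "q < 1" "0 < m"
  shows "1 \<le> q_int q m"
proof -
  have "q ^ m \<le> q ^ 1"
    using assms by (intro power_decreasing) auto
  then show ?thesis
    using assms by (simp add: q_int_def field_simps)
qed

lemma q_int_minus_pos:
  assumes "0 < q" "q < 1" "\<bar>x\<bar> < 1" "0 < m"
  shows "0 < q_int q m - q ^ m * x"
proof -
  have "q ^ m \<le> 1"
    using assms by (intro power_le_one) auto
  then have "q ^ m * \<bar>x\<bar> \<le> 1 * \<bar>x\<bar>"
    by (intro mult_right_mono) auto
  moreover have "q ^ m * x \<le> q ^ m * \<bar>x\<bar>"
    using assms by (intro mult_left_mono) auto
  ultimately show ?thesis
    using q_int_ge_1[of q m] assms by linarith
qed

lemma f_q_pos: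
  assumes "0 < q" "q < 1" "\<bar>x\<bar> < 1"
  shows "0 < f_q q m x"
  unfolding f_q_def by (intro prod_pos) (use assms q_int_minus_pos in auto)

lemma chain_weight_pos:
  assumes "0 < q" "q < 1" "\<bar>x\<bar> < 1" "ms \<in> chains (length ks)"
  shows "0 < chain_weight q x ks ms"
  unfolding chain_weight_def
proof (intro prod_pos ballI)
  fix i assume "i \<in> {..<length ks}"
  then have "ms ! i \<in> set ms"
    using assms(4) by (auto simp: chains_def)
  then have m: "0 < ms ! i"
    using assms(4) by (auto simp: chains_def)
  have "0 < q_int q (ms ! i)"
    using q_int_ge_1[OF assms(1,2) m] by linarith
  then show "0 < q ^ ((ks ! i - 1) * ms ! i) /
      ((q_int q (ms ! i) - q ^ (ms ! i) * x) * q_int q (ms ! i) ^ (ks ! i - 1))"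
    using q_int_minus_pos[OF assms(1-3) m] assms(1) by simp
qed

lemma Z_term_pos:
  assumes "0 < q" "q < 1" "\<bar>x\<bar> < 1"
    and "ms \<in> chains (length ks)" "ns \<in> chains (length ls)"
  shows "0 < Z_term q x ks ls ms ns"
  using assms by (simp add: Z_term_def connector_def chain_weight_pos f_q_pos)

lemma Z_q_pos:
  assumes "0 < q" "q < 1" "\<bar>x\<bar> < 1"
  shows "0 < Z_q q ks ls x"
proof -
  let ?f = "\<lambda>(ms, ns). ennreal (Z_term q x ks ls ms ns)"
  let ?A = "chains (length ks) \<times> chains (length ls)"
  define p where "p = ([1..<Suc (length ks)], [1..<Suc (length ls)])"
  have "[1..<Suc r] \<in> chains r" for r
    by (auto simp: chains_def simp del: upt_Suc)
  then have p: "p \<in> ?A"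
    by (simp add: p_def del: upt_Suc)
  then have "0 < ?f p"
    using Z_term_pos[OF assms] by auto
  also have "?f p = infsum ?f {p}"
    by simp
  also have "\<dots> \<le> infsum ?f ?A"
    using p by (intro infsum_mono_neutral nonneg_summable_on_complete) auto
  finally show ?thesis
    by (simp add: Z_q_def)
qed

end

(*
  The theorem is the transport relation for the connector C(m,n) = connector q x m n.  From
  [a+n] = [n] + q^n [a] one gets, for a > 0,
    C(a,n) / ([a] - q^a x) = (q^n / [n]) (C(a-1,n) - C(a,n)),
  and C(a,n) -> 0 as a -> infinity for n > 0.  Summing over the last entry a > m of the left chain
  therefore telescopes to (q^n / [n]) C(m,n), which raises the last exponent on the right by one.
  The second equation is the first one after exchanging the two indices.
*)
theory Submission
  imports Defs
begin

text \<open>Tonelli for unconditional sums in \<open>ennreal\<close>, with no summability to check.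
  Both sides are suprema over finite sets, so each inequality reduces to a finite set of outer
  indices, where the sum splits into disjoint fibres.\<close>

lemma infsum_Sigma_ennreal:
  fixes f :: "'a \<times> 'b \<Rightarrow> ennreal"
  shows "infsum f (Sigma A B) = (\<Sum>\<^sub>\<infinity>x\<in>A. \<Sum>\<^sub>\<infinity>y\<in>B x. f (x, y))"
proof (rule antisym)
  have fin: "infsum f (Sigma F B) = (\<Sum>x\<in>F. \<Sum>\<^sub>\<infinity>y\<in>B x. f (x, y))" if "finite F" for F
    using that
  proof induction
    case (insert x F)
    have "Sigma (insert x F) B = Pair x ` B x \<union> Sigma F B"
      by auto
    moreover have "infsum f (Pair x ` B x) = (\<Sum>\<^sub>\<infinity>y\<in>B x. f (x, y))"
      by (subst infsum_reindex) (auto simp: inj_on_def o_def)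
    moreover have "infsum f (Pair x ` B x \<union> Sigma F B) = infsum f (Pair x ` B x) + infsum f (Sigma F B)"
      using insert.hyps by (intro infsum_Un_disjoint nonneg_summable_on_complete) auto
    ultimately show ?case
      using insert by simp
  qed simp
  show "infsum f (Sigma A B) \<le> (\<Sum>\<^sub>\<infinity>x\<in>A. \<Sum>\<^sub>\<infinity>y\<in>B x. f (x, y))"
    unfolding nonneg_infsum_complete[of "Sigma A B" f, OF zero_le]
  proof (rule SUP_least, safe)
    fix F assume F: "finite F" "F \<subseteq> Sigma A B"
    have "sum f F = infsum f F"
      using F by simp
    also have "\<dots> \<le> infsum f (Sigma (fst ` F) B)"
      using F by (intro infsum_mono_neutral nonneg_summable_on_complete) (auto intro: rev_image_eqI)
    also have "\<dots> = (\<Sum>\<^sub>\<infinity>x\<in>fst ` F. \<Sum>\<^sub>\<infinity>y\<in>B x. f (x, y))"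
      using F by (simp add: fin)
    also have "\<dots> \<le> (\<Sum>\<^sub>\<infinity>x\<in>A. \<Sum>\<^sub>\<infinity>y\<in>B x. f (x, y))"
      using F by (intro infsum_mono_neutral nonneg_summable_on_complete) auto
    finally show "sum f F \<le> (\<Sum>\<^sub>\<infinity>x\<in>A. \<Sum>\<^sub>\<infinity>y\<in>B x. f (x, y))" .
  qed
  show "(\<Sum>\<^sub>\<infinity>x\<in>A. \<Sum>\<^sub>\<infinity>y\<in>B x. f (x, y)) \<le> infsum f (Sigma A B)"
    unfolding nonneg_infsum_complete[of A "\<lambda>x. \<Sum>\<^sub>\<infinity>y\<in>B x. f (x, y)", OF zero_le]
  proof (rule SUP_least, safe)
    fix F assume F: "finite F" "F \<subseteq> A"
    then have "(\<Sum>x\<in>F. \<Sum>\<^sub>\<infinity>y\<in>B x. f (x, y)) = infsum f (Sigma F B)"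
      by (simp add: fin)
    also have "\<dots> \<le> infsum f (Sigma A B)"
      using F by (intro infsum_mono_neutral nonneg_summable_on_complete) auto
    finally show "(\<Sum>x\<in>F. \<Sum>\<^sub>\<infinity>y\<in>B x. f (x, y)) \<le> infsum f (Sigma A B)" .
  qed
qed

text \<open>Carries the telescoping series from the reals, where differences make sense, over to
  \<open>ennreal\<close>. Nonnegative terms make the ordered and the unordered sum agree.\<close>

lemma infsum_ennreal_sums:
  fixes f :: "nat \<Rightarrow> real"
  assumes "f sums S" "\<And>n. 0 \<le> f n"
  shows "(\<Sum>\<^sub>\<infinity>n. ennreal (f n)) = ennreal S"
proof -
  have f: "(f has_sum S) UNIV"
    using assms by (rule sums_nonneg_imp_has_sum)
  then have "ennreal (infsum f UNIV) = (\<Sum>\<^sub>\<infinity>n. ennreal (f n))"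
    using assms(2) unfolding infsum_nonneg_is_SUPREMUM_ennreal[OF has_sum_imp_summable[OF f] assms(2)]
    by (simp add: nonneg_infsum_complete sum_ennreal)
  with f show ?thesis
    by (simp add: infsumI)
qed

lemma f_q_Suc: "f_q q (Suc m) x = f_q q m x * (q_int q (Suc m) - q ^ Suc m * x)"
  by (simp add: f_q_def)

lemma q_int_add: "q \<noteq> 1 \<Longrightarrow> q_int q (a + n) = q_int q n + q ^ n * q_int q a"
  by (simp add: q_int_def field_simps power_add)

lemma connector_commute: "connector q x m n = connector q x n m"
  by (simp add: connector_def mult.commute add.commute mult.left_commute)

lemma connector_pos:
  "0 < q \<Longrightarrow> q < 1 \<Longrightarrow> \<bar>x\<bar> < 1 \<Longrightarrow> 0 < connector q x m n"
  by (simp add: connector_def f_q_pos)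

text \<open>Passing from \<open>a\<close> to \<open>Suc a\<close> multiplies the connector by
  \<open>q ^ n * D (Suc a) / D (Suc a + n)\<close>, with \<open>D\<close> as defined below. One
  minus this factor is \<open>q_int q n / D (Suc a + n)\<close>.\<close>

lemma connector_telescope:
  assumes "0 < q" "q < 1" "\<bar>x\<bar> < 1" "0 < n"
  shows "connector q x (Suc a) n / (q_int q (Suc a) - q ^ Suc a * x) =
    q ^ n / q_int q n * (connector q x a n - connector q x (Suc a) n)"
proof -
  define D where "D m = q_int q m - q ^ m * x" for m
  have D: "0 < D (Suc a)" "0 < D (Suc a + n)"
    using q_int_minus_pos[OF assms(1-3)] by (auto simp: D_def simp del: power_Suc)
  have N: "0 < q_int q n"
    using q_int_ge_1[of q n] assms by linarith
  \<comment> \<open>The terms in \<open>x\<close> agree on both sides, which leaves the addition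
    rule for \<open>q_int\<close>.\<close>
  have rec: "D (Suc a + n) = q_int q n + q ^ n * D (Suc a)"
    using assms q_int_add[of q "Suc a" n] by (simp add: D_def algebra_simps power_add)
  define E where "E = D (Suc a + n)"
  have E: "0 < E"
    using D(2) by (simp only: E_def)
  define T where "T = q ^ (a * n) * f_q q a x * f_q q n x / f_q q (a + n) x"
  have C: "connector q x a n = T"
    by (simp add: connector_def T_def)
  have C': "connector q x (Suc a) n = T * q ^ n * D (Suc a) / E"
    by (simp add: connector_def f_q_Suc T_def E_def D_def power_add)
  have "T - T * q ^ n * D (Suc a) / E = T * (E - q ^ n * D (Suc a)) / E"
    using E by (simp add: right_diff_distrib diff_divide_distrib mult.assoc)
  also have "E - q ^ n * D (Suc a) = q_int q n"
    using rec by (simp add: E_def)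
  finally have "T - T * q ^ n * D (Suc a) / E = T * q_int q n / E" .
  then show ?thesis
    unfolding C C' D_def[symmetric] using D(1) N E by simp
qed

text \<open>The quotient \<open>f_q q a x / f_q q (a + n) x\<close> is bounded uniformly in
  \<open>a\<close>, while \<open>q ^ (a * n)\<close> decays geometrically because \<open>n\<close>
  is positive.\<close>

lemma connector_tendsto_0:
  assumes "0 < q" "q < 1" "\<bar>x\<bar> < 1" "0 < n"
  shows "(\<lambda>a. connector q x a n) \<longlonglongrightarrow> 0"
proof -
  \<comment> \<open>A lower bound for every factor of \<open>f_q\<close>: the q-integer is at least
    1 and the subtracted term is at most \<open>\<bar>x\<bar>\<close>.\<close>
  define d where "d = 1 - \<bar>x\<bar>"
  have d: "0 < d"
    using assms by (simp add: d_def)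
  have fac: "d \<le> q_int q (Suc h) - q ^ Suc h * x" for h
  proof -
    have "q ^ Suc h * x \<le> q ^ Suc h * \<bar>x\<bar>"
      using assms by (intro mult_left_mono) auto
    also have "\<dots> \<le> 1 * \<bar>x\<bar>"
      using assms by (intro mult_right_mono power_le_one) auto
    finally show ?thesis
      using q_int_ge_1[of q "Suc h"] assms by (simp add: d_def)
  qed
  have f_ge: "f_q q a x * d ^ k \<le> f_q q (a + k) x" for a k
  proof (induction k)
    case (Suc k)
    have "f_q q a x * d ^ k * d \<le> f_q q (a + k) x * (q_int q (Suc (a + k)) - q ^ Suc (a + k) * x)"
      using Suc fac d f_q_pos[OF assms(1-3)] by (intro mult_mono) (auto intro: less_imp_le)
    then show ?case
      by (simp add: f_q_Suc mult_ac)
  qed simp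
  have bound: "connector q x a n \<le> (q ^ n) ^ a * (f_q q n x / d ^ n)" for a
  proof -
    have "f_q q a x / f_q q (a + n) x \<le> 1 / d ^ n"
      using f_ge[of a n] d f_q_pos[OF assms(1-3)] by (simp add: field_simps)
    then have "q ^ (a * n) * f_q q n x * (f_q q a x / f_q q (a + n) x) \<le>
        q ^ (a * n) * f_q q n x * (1 / d ^ n)"
      using assms f_q_pos[OF assms(1-3)] by (intro mult_left_mono) (auto intro: less_imp_le)
    then show ?thesis
      by (simp add: connector_def mult_ac flip: power_mult)
  qed
  have lim: "(\<lambda>a. (q ^ n) ^ a * (f_q q n x / d ^ n)) \<longlonglongrightarrow> 0"
    using assms by (intro tendsto_mult_left_zero LIMSEQ_power_zero) (simp add: power_less_one_iff)
  show ?thesis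
  proof (rule tendsto_sandwich[OF _ _ tendsto_const lim])
    show "\<forall>\<^sub>F a in sequentially. 0 \<le> connector q x a n"
      using connector_pos[OF assms(1-3)] by (simp add: less_imp_le)
  qed (use bound in simp)
qed

text \<open>The sum over the last entry \<open>a\<close> of the left chain, whose previous entry is
  \<open>m\<close>; \<open>w\<close> collects the factors independent of \<open>a\<close>.\<close>

lemma infsum_connector:
  assumes "0 < q" "q < 1" "\<bar>x\<bar> < 1" "0 < n" "0 \<le> w"
  shows "(\<Sum>\<^sub>\<infinity>a\<in>{m<..}. ennreal (w * (connector q x a n / (q_int q a - q ^ a * x)))) =
    ennreal (w * (q ^ n / q_int q n * connector q x m n))"
proof -
  let ?g = "\<lambda>a. w * (connector q x a n / (q_int q a - q ^ a * x))"
  \<comment> \<open>The shift by \<open>Suc m\<close> lets the telescoping sum start at the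
    connector of \<open>m\<close> itself.\<close>
  have bij: "bij_betw (\<lambda>i. Suc (m + i)) UNIV {m<..}"
    by (rule bij_betwI[of _ _ _ "\<lambda>a. a - Suc m"]) auto
  have "(\<lambda>i. connector q x (m + i) n) \<longlonglongrightarrow> 0"
    using connector_tendsto_0[OF assms(1-4)] by (subst add.commute) (rule LIMSEQ_ignore_initial_segment)
  then have "(\<lambda>i. w * (q ^ n / q_int q n * (connector q x (m + i) n - connector q x (m + Suc i) n)))
      sums (w * (q ^ n / q_int q n * (connector q x (m + 0) n - 0)))"
    by (intro sums_mult telescope_sums')
  then have "(\<lambda>i. ?g (Suc (m + i))) sums (w * (q ^ n / q_int q n * connector q x m n))"
    using assms connector_telescope[OF assms(1-4)] by simp
  moreover have "0 \<le> ?g (Suc (m + i))" for i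
    using assms connector_pos[OF assms(1-3)] q_int_minus_pos[OF assms(1-3)]
    by (auto intro!: mult_nonneg_nonneg divide_nonneg_nonneg intro: less_imp_le simp del: power_Suc)
  ultimately have "(\<Sum>\<^sub>\<infinity>i. ennreal (?g (Suc (m + i)))) =
      ennreal (w * (q ^ n / q_int q n * connector q x m n))"
    by (rule infsum_ennreal_sums)
  then show ?thesis
    unfolding infsum_reindex_bij_betw[OF bij, of "\<lambda>a. ennreal (?g a)"] .
qed

lemma chain_weight_snoc:
  assumes "length ms = length ks"
  shows "chain_weight q x (ks @ [k]) (ms @ [a]) = chain_weight q x ks ms *
    (q ^ ((k - 1) * a) / ((q_int q a - q ^ a * x) * q_int q a ^ (k - 1)))"
  using assms by (simp add: chain_weight_def nth_append)

text \<open>By transitivity, exceeding the last entry means exceeding all of them; the prepended 0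
  covers the empty chain and keeps \<open>a\<close> positive.\<close>

lemma snoc_in_chains_iff:
  "ms @ [a] \<in> chains (Suc r) \<longleftrightarrow> ms \<in> chains r \<and> last (0 # ms) < a"
proof -
  have "m < a" if "sorted_wrt (<) (0 # ms)" "last (0 # ms) < a" "m \<in> set (0 # ms)" for m
  proof (cases ms rule: rev_cases)
    case (snoc ms' b)
    then show ?thesis
      using that by (auto simp: sorted_wrt_append)
  qed (use that in auto)
  then have "ms \<in> chains r \<Longrightarrow> last (0 # ms) < a \<Longrightarrow> \<forall>m\<in>set (0 # ms). m < a"
    by (simp only: chains_def mem_Collect_eq) blast
  moreover have "ms @ [a] \<in> chains (Suc r) \<longleftrightarrow> ms \<in> chains r \<and> (\<forall>m\<in>set (0 # ms). m < a)"
    by (auto simp: chains_def sorted_wrt_append)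
  moreover have "last (0 # ms) \<in> set (0 # ms)"
    by (rule last_in_set) simp
  ultimately show ?thesis
    by blast
qed

text \<open>Splits off the last entry of the left chain. Its range depends on the remaining entries,
  hence the dependent product.\<close>

lemma bij_betw_chains_Suc:
  "bij_betw (\<lambda>((ms, ns), a). (ms @ [a], ns))
     (SIGMA p : chains r \<times> B. {last (0 # fst p)<..}) (chains (Suc r) \<times> B)"
proof (rule bij_betwI')
  fix y assume y: "y \<in> chains (Suc r) \<times> B"
  then have "fst y \<noteq> []"
    by (auto simp: chains_def)
  then obtain ms a where "fst y = ms @ [a]"
    by (metis rev_exhaust)
  with y have "y = (ms @ [a], snd y)" "ms @ [a] \<in> chains (Suc r)" "snd y \<in> B"
    by auto
  then show "\<exists>p \<in> SIGMA p : chains r \<times> B. {last (0 # fst p)<..}. y = (\<lambda>((ms, ns), a). (ms @ [a], ns)) p"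
    by (intro bexI[of _ "((ms, snd y), a)"]) (simp_all only: snoc_in_chains_iff, auto)
qed (auto simp: snoc_in_chains_iff)

lemma Z_q_commute: "Z_q q ks ls x = Z_q q ls ks x"
  unfolding Z_q_def
  by (rule infsum_reindex_bij_witness[of _ prod.swap prod.swap])
    (auto simp: Z_term_def connector_commute mult_ac)

lemma Z_q_transport:
  assumes "0 < q" "q < 1" "\<bar>x\<bar> < 1" "0 < l"
  shows "Z_q q (ks @ [1]) (ls @ [l]) x = Z_q q ks (ls @ [l + 1]) x"
proof -
  let ?A = "chains (length ks) \<times> chains (Suc (length ls))"
  have inner: "(\<Sum>\<^sub>\<infinity>a\<in>{last (0 # ms)<..}. ennreal (Z_term q x (ks @ [1]) (ls @ [l]) (ms @ [a]) ns)) =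
      ennreal (Z_term q x ks (ls @ [l + 1]) ms ns)" (is "?L = _")
    if ms: "ms \<in> chains (length ks)" and ns: "ns \<in> chains (Suc (length ls))" for ms ns
  proof -
    obtain ns' n where ns': "ns = ns' @ [n]"
      using ns by (cases ns rule: rev_cases) (auto simp: chains_def)
    \<comment> \<open>The right index is non-empty, so \<open>n\<close> is a genuine entry and not
      the default 0; the connector tends to 0 only then.\<close>
    have n: "0 < n"
      using ns by (auto simp: ns' chains_def)
    have len: "length ms = length ks" "length ns' = length ls"
      using ms ns by (auto simp: ns' chains_def)
    define w where "w = chain_weight q x ks ms * chain_weight q x (ls @ [l]) ns"
    have "0 \<le> w"
      using chain_weight_pos[OF assms(1-3) ms] chain_weight_pos[OF assms(1-3), of ns "ls @ [l]"] ns
      by (simp add: w_def less_imp_le)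
    have "?L = (\<Sum>\<^sub>\<infinity>a\<in>{last (0 # ms)<..}. ennreal (w * (connector q x a n / (q_int q a - q ^ a * x))))"
      \<comment> \<open>For the appended exponent 1 both powers are trivial, so \<open>a\<close>
        contributes only the reciprocal of \<open>q_int q a - q ^ a * x\<close> and the
        connector.\<close>
      by (simp add: Z_term_def chain_weight_snoc len w_def ns' mult_ac)
    also have "\<dots> = ennreal (w * (q ^ n / q_int q n * connector q x (last (0 # ms)) n))"
      by (rule infsum_connector) fact+
    also have "w * (q ^ n / q_int q n * connector q x (last (0 # ms)) n) =
        Z_term q x ks (ls @ [l + 1]) ms ns"
      \<comment> \<open>The factor \<open>q ^ n / q_int q n\<close> raises the exponent
        \<open>l - 1\<close> to \<open>l\<close>; positivity of \<open>l\<close> keeps the natural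
        subtraction from truncating.\<close>
      using \<open>0 < l\<close> by (cases l) (simp_all add: Z_term_def chain_weight_snoc len w_def ns' power_add mult_ac)
    finally show ?thesis .
  qed
  have "Z_q q (ks @ [1]) (ls @ [l]) x =
      (\<Sum>\<^sub>\<infinity>p\<in>(SIGMA p : ?A. {last (0 # fst p)<..}).
        (\<lambda>(ms, ns). ennreal (Z_term q x (ks @ [1]) (ls @ [l]) ms ns)) ((\<lambda>((ms, ns), a). (ms @ [a], ns)) p))"
    unfolding infsum_reindex_bij_betw[OF bij_betw_chains_Suc] by (simp add: Z_q_def)
  also have "\<dots> = (\<Sum>\<^sub>\<infinity>p\<in>?A. \<Sum>\<^sub>\<infinity>a\<in>{last (0 # fst p)<..}.
      ennreal (Z_term q x (ks @ [1]) (ls @ [l]) (fst p @ [a]) (snd p)))"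
    by (simp add: infsum_Sigma_ennreal case_prod_unfold)
  also have "\<dots> = (\<Sum>\<^sub>\<infinity>(ms, ns)\<in>?A. ennreal (Z_term q x ks (ls @ [l + 1]) ms ns))"
    by (intro infsum_cong) (simp only: inner mem_Times_iff case_prod_unfold)
  also have "\<dots> = Z_q q ks (ls @ [l + 1]) x"
    by (simp add: Z_q_def)
  finally show ?thesis .
qed

theorem theorem4:
  fixes q x :: real and ks ls :: "nat list"
  assumes "0 < q" and "q < 1" and "\<bar>x\<bar> < 1"
    and "is_index ks" and "is_index ls"
  shows "(length ls > 0 \<longrightarrow>
            Z_q q (ks @ [1]) ls x = Z_q q ks (butlast ls @ [last ls + 1]) x) \<and>
         (length ks > 0 \<longrightarrow>
            Z_q q (butlast ks @ [last ks + 1]) ls x = Z_q q ks (ls @ [1]) x)"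
proof -
  have transport: "Z_q q (as @ [1]) bs x = Z_q q as (butlast bs @ [last bs + 1]) x"
    if "is_index bs" "length bs > 0" for as bs
  proof -
    have "bs \<noteq> []"
      using that by simp
    then have "0 < last bs"
      using that by (auto simp: is_index_def)
    from Z_q_transport[OF assms(1-3) this, of as "butlast bs"] \<open>bs \<noteq> []\<close> show ?thesis
      by simp
  qed
  show ?thesis
    \<comment> \<open>The second instance has the two indices exchanged; symmetry of
      \<open>Z_q\<close> turns it into the second equation, read from right to left.\<close>
    using transport[of ls ks] transport[of ks ls] assms(4,5)
    by (metis Z_q_commute)
qed

end
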